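(* Let $n=2p$ and let $N$ be an $n\times n$ real positive definite matrix that is also symplectic. If $N$ is irreducible (equivalently, the graph $\mathcal G(N)$ is connected), then $$\#(N)\ \ge\ 4n-4$$ and $\mathcal G(N)$ has at least $3p-2$ edges. These bounds are sharp: for every integer $p\ge 1$ there is an irreducible symplectic positive definite $2p\times 2p$ matrix $N$ with $\#(N)=4n-4$ and with exactly $3p-2$ edges in $\mathcal G(N)$.
   Context: $\Omega=\begin{bmatrix}O&I_p\\-I_p&O\end{bmatrix}$; a real $2p\times 2p$ matrix $S$ is symplectic if $S^\top\Omega S=\Omega$. Positive definite matrices are by definition real symmetric. $\#(A)$ is the number of nonzero entries of $A$. For a symmetric $n\times n$ matrix $N=[n_{ij}]$, $\mathcal G(N)$ is the simple graph on vertices $1,\dots,n$ with edge $ij$ ($i\ne j$) if and only if $n_{ij}\ne 0$. A square matrix $A$ is reducible if $PAP^\top$ is block upper triangular with at least two non-vacuous square diagonal blocks for some permutation matrix $P$, and irreducible otherwise. *)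

theory Defs
  imports
    "Jordan_Normal_Form.Matrix"
    "Graph_Theory.Graph_Theory"
    "HOL-Combinatorics.Permutations"
begin

definition Omega_mat :: "nat \<Rightarrow> real mat" where
  "Omega_mat p = four_block_mat (0\<^sub>m p p) (1\<^sub>m p) (- 1\<^sub>m p) (0\<^sub>m p p)"

definition symplectic_mat :: "nat \<Rightarrow> real mat \<Rightarrow> bool" where
  "symplectic_mat p S \<longleftrightarrow>
     S \<in> carrier_mat (2 * p) (2 * p) \<and> transpose_mat S * Omega_mat p * S = Omega_mat p"

definition pos_def_mat :: "real mat \<Rightarrow> bool" where
  "pos_def_mat A \<longleftrightarrow>
     square_mat A \<and> transpose_mat A = A \<and>
     (\<forall>x \<in> carrier_vec (dim_row A). x \<noteq> 0\<^sub>v (dim_row A) \<longrightarrow> x \<bullet> (A *\<^sub>v x) > 0)"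

definition num_nonzero :: "'a :: zero mat \<Rightarrow> nat" where
  "num_nonzero A = card {(i, j). i < dim_row A \<and> j < dim_col A \<and> A $$ (i, j) \<noteq> 0}"

text \<open>A simple graph is represented by the symmetric loop-free digraph that contains both
  orientations of each edge. Vertices are numbered from 0, like matrix indices.\<close>

definition mat_graph :: "'a :: zero mat \<Rightarrow> nat pair_pre_digraph" where
  "mat_graph N =
     \<lparr> pverts = {..<dim_row N},
       parcs = {(i, j). i < dim_row N \<and> j < dim_row N \<and> i \<noteq> j \<and> N $$ (i, j) \<noteq> 0} \<rparr>"

text \<open>Undirected edges: the two orientations of an edge yield the same unordered pair.\<close>

definition graph_edges :: "'v pair_pre_digraph \<Rightarrow> 'v set set" where
  "graph_edges G = (\<lambda>(u, v). {u, v}) ` parcs G"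

lemma pair_graph_mat_graph:
  assumes "square_mat N" "transpose_mat N = N"
  shows "pair_graph (mat_graph N)"
proof -
  have sym: "N $$ (j, i) = N $$ (i, j)" if "i < dim_row N" "j < dim_row N" for i j
    using that assms index_transpose_mat(1)[of i N j] by simp
  have "finite ({..<dim_row N} \<times> {..<dim_row N})" by simp
  then have "finite {(i, j). i < dim_row N \<and> j < dim_row N \<and> i \<noteq> j \<and> N $$ (i, j) \<noteq> 0}"
    by (rule rev_finite_subset) auto
  then show ?thesis
    by unfold_locales
      (auto simp: mat_graph_def symmetric_def sym_def sym)
qed

definition permutation_mat :: "nat \<Rightarrow> 'a :: semiring_1 mat \<Rightarrow> bool" where
  "permutation_mat n P \<longleftrightarrow>
     (\<exists>\<sigma>. \<sigma> permutes {..<n} \<and> P = mat n n (\<lambda>(i, j). if j = \<sigma> i then 1 else 0))"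

text \<open>The list \<open>ks\<close> gives the sizes of the diagonal blocks, so that block number \<open>a\<close> starts at
  index \<open>sum_list (take a ks)\<close>. Being zero below the diagonal blocks means that, for every block
  \<open>a\<close>, all entries in the rows from the start of this block on and in the columns
  before it vanish.\<close>

definition block_upper_triangular :: "nat list \<Rightarrow> 'a :: zero mat \<Rightarrow> bool" where
  "block_upper_triangular ks A \<longleftrightarrow>
     A \<in> carrier_mat (sum_list ks) (sum_list ks) \<and>
     (\<forall>a < length ks. \<forall>i < sum_list ks. \<forall>j < sum_list (take a ks).
        sum_list (take a ks) \<le> i \<longrightarrow> A $$ (i, j) = 0)"

definition reducible_mat :: "'a :: semiring_1 mat \<Rightarrow> bool" where
  "reducible_mat A \<longleftrightarrow>
     square_mat A \<and>
     (\<exists>P ks. permutation_mat (dim_row A) P \<and> length ks \<ge> 2 \<and> (\<forall>k \<in> set ks. k > 0) \<and>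
        block_upper_triangular ks (P * A * transpose_mat P))"

definition irreducible_mat :: "'a :: semiring_1 mat \<Rightarrow> bool" where
  "irreducible_mat A \<longleftrightarrow> square_mat A \<and> \<not> reducible_mat A"

end

theory Submission
  imports Defs
begin

text \<open>A symmetric symplectic matrix satisfies \<open>N \<Omega> N = \<Omega>\<close>, so its inverse is \<open>- \<Omega> N \<Omega>\<close>. As \<open>\<Omega>\<close> is
  a signed permutation matrix, the graph of \<open>N\<close> is isomorphic to the graph of the inverse, and the
  lower bound follows from a statement about all positive definite matrices: if \<open>N\<close> is irreducible
  of size \<open>n\<close> and \<open>M\<close> is its inverse, then the graphs of \<open>N\<close> and \<open>M\<close> have at least
  \<open>3 n - 4\<close> edges together (\<open>inverse_pair_arcs\<close>, where every edge counts as two arcs). For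
  \<open>n = 2 p\<close> and two graphs with equally many edges this gives \<open>3 p - 2\<close> edges. The diagonal entries
  are positive, so there are at least \<open>2 p + 2 (3 p - 2) = 4 n - 4\<close> nonzero entries.

  The statement about \<open>N\<close> and \<open>M\<close> is proved by induction on the size. If \<open>v\<close> is a cut vertex of
  the graph of \<open>M\<close>, then the block of \<open>N\<close> between the two sides of \<open>v\<close> has rank one, and the pair splits
  into two smaller pairs that overlap in \<open>v\<close> (\<open>separates_piece\<close>); the bounds for the pieces,
  together with an edge of \<open>N\<close> between the sides, give the bound (\<open>separates_arc_step\<close>). The same
  applies to a cut vertex of \<open>N\<close>. Without cut vertices all degrees are at
  least two if \<open>n \<ge> 3\<close>. A vertex of degree two in one graph is eliminated there by a Schur complement
  and deleted from the other, which costs at least three edges in total (\<open>degree_two_arc_step\<close>).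
  In the remaining case all degrees are at least three and the two graphs have at least \<open>3 n\<close> edges.

  The bounds are attained by \<open>[1, X; X, X\<^sup>2 + 1]\<close>, where \<open>X\<close> is the adjacency matrix of a path with a
  loop at one end.\<close>


section \<open>Mutually inverse positive definite forms\<close>

text \<open>Matrices are functions on a finite index set here, because the induction below passes to
  principal submatrices on arbitrary subsets of the index set.\<close>
definition sym_on :: "'a set \<Rightarrow> ('a \<Rightarrow> 'a \<Rightarrow> real) \<Rightarrow> bool" where
  "sym_on V N \<longleftrightarrow> (\<forall>i\<in>V. \<forall>j\<in>V. N i j = N j i)"

definition pos_def_on :: "'a set \<Rightarrow> ('a \<Rightarrow> 'a \<Rightarrow> real) \<Rightarrow> bool" where
  "pos_def_on V N \<longleftrightarrow>
     (\<forall>x. (\<exists>i\<in>V. x i \<noteq> 0) \<longrightarrow> (\<Sum>i\<in>V. \<Sum>j\<in>V. x i * N i j * x j) > 0)"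

definition inverse_pair :: "'a set \<Rightarrow> ('a \<Rightarrow> 'a \<Rightarrow> real) \<Rightarrow> ('a \<Rightarrow> 'a \<Rightarrow> real) \<Rightarrow> bool" where
  "inverse_pair V N M \<longleftrightarrow>
     finite V \<and> sym_on V N \<and> sym_on V M \<and> pos_def_on V N \<and>
     (\<forall>i\<in>V. \<forall>j\<in>V. (\<Sum>k\<in>V. N i k * M k j) = (if i = j then 1 else 0))"

text \<open>For symmetric \<open>N\<close> on a nonempty set this says at once that the graph of \<open>N\<close> is
  connected and that no simultaneous permutation of rows and columns makes \<open>N\<close> block triangular.\<close>
definition connected_on :: "'a set \<Rightarrow> ('a \<Rightarrow> 'a \<Rightarrow> real) \<Rightarrow> bool" where
  "connected_on V N \<longleftrightarrow>
     (\<forall>R. R \<subseteq> V \<and> R \<noteq> {} \<and> R \<noteq> V \<longrightarrow> (\<exists>i\<in>R. \<exists>j\<in>V - R. N i j \<noteq> 0))"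

definition nbrs :: "'a set \<Rightarrow> ('a \<Rightarrow> 'a \<Rightarrow> real) \<Rightarrow> 'a \<Rightarrow> 'a set" where
  "nbrs V N v = {j \<in> V. j \<noteq> v \<and> N v j \<noteq> 0}"

text \<open>Every edge of the graph contributes both of its orientations.\<close>
definition arcs_on :: "'a set \<Rightarrow> ('a \<Rightarrow> 'a \<Rightarrow> real) \<Rightarrow> ('a \<times> 'a) set" where
  "arcs_on V N = (SIGMA i:V. nbrs V N i)"

lemma connected_onD:
  assumes "connected_on V N" "R \<subseteq> V" "R \<noteq> {}" "R \<noteq> V"
  shows "\<exists>i\<in>R. \<exists>j\<in>V - R. N i j \<noteq> 0"
  using assms unfolding connected_on_def by blast

lemma inverse_pairD:
  assumes "inverse_pair V N M"
  shows "finite V" "\<And>i j. i \<in> V \<Longrightarrow> j \<in> V \<Longrightarrow> N i j = N j i"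
    "\<And>i j. i \<in> V \<Longrightarrow> j \<in> V \<Longrightarrow> M i j = M j i"
    "\<And>i j. i \<in> V \<Longrightarrow> j \<in> V \<Longrightarrow> (\<Sum>k\<in>V. N i k * M k j) = (if i = j then 1 else 0)"
    "pos_def_on V N"
  using assms unfolding inverse_pair_def sym_on_def by blast+

lemma pos_def_on_subset:
  assumes "finite V" "pos_def_on V N" "R \<subseteq> V"
  shows "pos_def_on R N"
  unfolding pos_def_on_def
proof (intro allI impI)
  fix x :: "'a \<Rightarrow> real" assume nz: "\<exists>i\<in>R. x i \<noteq> 0"
  define y where "y k = (if k \<in> R then x k else 0)" for k
  have "\<exists>i\<in>V. y i \<noteq> 0" using nz assms(3) by (auto simp: y_def)
  hence "0 < (\<Sum>i\<in>V. \<Sum>j\<in>V. y i * N i j * y j)"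
    using assms(2) unfolding pos_def_on_def by blast
  also have "(\<Sum>i\<in>V. \<Sum>j\<in>V. y i * N i j * y j) = (\<Sum>i\<in>R. \<Sum>j\<in>V. y i * N i j * y j)"
    using assms(1,3) by (intro sum.mono_neutral_right) (auto simp: y_def)
  also have "\<dots> = (\<Sum>i\<in>R. \<Sum>j\<in>R. y i * N i j * y j)"
    using assms(1,3) by (intro sum.cong refl sum.mono_neutral_right) (auto simp: y_def)
  also have "\<dots> = (\<Sum>i\<in>R. \<Sum>j\<in>R. x i * N i j * x j)"
    by (simp add: y_def)
  finally show "0 < (\<Sum>i\<in>R. \<Sum>j\<in>R. x i * N i j * x j)" .
qed

lemma pos_def_on_kernel:
  assumes "pos_def_on R N"
    and "\<And>i. i \<in> R \<Longrightarrow> (\<Sum>k\<in>R. N i k * x k) = 0"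
    and "i \<in> R"
  shows "x i = 0"
proof (rule ccontr)
  assume "x i \<noteq> 0"
  hence "0 < (\<Sum>i\<in>R. \<Sum>j\<in>R. x i * N i j * x j)"
    using assms(1,3) unfolding pos_def_on_def by blast
  also have "\<dots> = (\<Sum>i\<in>R. x i * (\<Sum>j\<in>R. N i j * x j))"
    by (simp add: sum_distrib_left mult.assoc)
  also have "\<dots> = 0" using assms(2) by simp
  finally show False by simp
qed

lemma pos_def_on_diag:
  assumes "finite V" "pos_def_on V N" "v \<in> V"
  shows "N v v > 0"
proof -
  have "pos_def_on {v} N" using pos_def_on_subset[of V N "{v}"] assms by simp
  thus ?thesis unfolding pos_def_on_def by (auto dest: spec[of _ "\<lambda>_. 1"])
qed

text \<open>With \<open>y = M x\<close> the form of \<open>M\<close> at \<open>x\<close> is the form of \<open>N\<close> at \<open>y\<close>, and \<open>y\<close> vanishes only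
  together with \<open>x = N y\<close>. The two members of a pair therefore play the same role.\<close>
lemma inverse_pair_swap:
  assumes "inverse_pair V N M"
  shows "inverse_pair V M N"
proof -
  note D = inverse_pairD[OF assms]
  have "(\<Sum>k\<in>V. M i k * N k j) = (if i = j then 1 else 0)" if ij: "i \<in> V" "j \<in> V" for i j
  proof -
    have "(\<Sum>k\<in>V. M i k * N k j) = (\<Sum>k\<in>V. N j k * M k i)"
      using D(2,3) ij by (intro sum.cong) (simp_all add: mult.commute)
    thus ?thesis using D(4)[OF ij(2,1)] by auto
  qed
  moreover have "pos_def_on V M"
    unfolding pos_def_on_def
  proof (intro allI impI)
    fix x :: "'a \<Rightarrow> real" assume nz: "\<exists>i\<in>V. x i \<noteq> 0"
    define y where "y k = (\<Sum>j\<in>V. M k j * x j)" for k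
    have Ny: "(\<Sum>k\<in>V. N i k * y k) = x i" if "i \<in> V" for i
    proof -
      have "(\<Sum>k\<in>V. N i k * y k) = (\<Sum>k\<in>V. \<Sum>j\<in>V. N i k * M k j * x j)"
        by (simp add: y_def sum_distrib_left mult.assoc)
      also have "\<dots> = (\<Sum>j\<in>V. (\<Sum>k\<in>V. N i k * M k j) * x j)"
        by (subst sum.swap) (simp add: sum_distrib_right)
      also have "\<dots> = (\<Sum>j\<in>V. (if i = j then 1 else 0) * x j)"
        using D(4) that by (intro sum.cong) auto
      also have "\<dots> = (\<Sum>j\<in>V. if i = j then x j else 0)"
        by (intro sum.cong) auto
      also have "\<dots> = x i" using D(1) that by simp
      finally show ?thesis .
    qed
    have "\<exists>i\<in>V. y i \<noteq> 0"
    proof (rule ccontr)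
      assume "\<not> ?thesis"
      hence "x i = 0" if "i \<in> V" for i using Ny[OF that] by simp
      thus False using nz by blast
    qed
    hence "0 < (\<Sum>i\<in>V. \<Sum>j\<in>V. y i * N i j * y j)"
      using D(5) unfolding pos_def_on_def by blast
    also have "\<dots> = (\<Sum>i\<in>V. y i * (\<Sum>j\<in>V. N i j * y j))"
      by (simp add: sum_distrib_left mult.assoc)
    also have "\<dots> = (\<Sum>i\<in>V. y i * x i)" using Ny by simp
    also have "\<dots> = (\<Sum>i\<in>V. \<Sum>j\<in>V. x i * M i j * x j)"
      by (simp add: y_def sum_distrib_left sum_distrib_right mult_ac)
    finally show "0 < (\<Sum>i\<in>V. \<Sum>j\<in>V. x i * M i j * x j)" .
  qed
  ultimately show ?thesis using assms unfolding inverse_pair_def by blast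
qed

text \<open>The columns of the block \<open>M[R,S]\<close> lie in the kernel of the positive definite submatrix
  \<open>N[R,R]\<close>.\<close>
lemma inverse_pair_block_zero:
  assumes P: "inverse_pair V N M" and RS: "V = R \<union> S" "R \<inter> S = {}"
    and Z: "\<And>i j. i \<in> R \<Longrightarrow> j \<in> S \<Longrightarrow> N i j = 0"
    and ij: "i \<in> R" "j \<in> S"
  shows "M i j = 0"
proof (rule pos_def_on_kernel[where N = N and R = R and x = "\<lambda>k. M k j"])
  note D = inverse_pairD[OF P]
  show "pos_def_on R N" using pos_def_on_subset[OF D(1,5)] RS by blast
  fix i assume i: "i \<in> R"
  have "(\<Sum>k\<in>R. N i k * M k j) = (\<Sum>k\<in>V. N i k * M k j)"
    using RS Z i D(1) by (intro sum.mono_neutral_left) auto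
  also have "\<dots> = 0" using D(4)[of i j] i ij RS by auto
  finally show "(\<Sum>k\<in>R. N i k * M k j) = 0" .
qed (rule ij(1))

lemma inverse_pair_connected:
  assumes P: "inverse_pair V N M" and C: "connected_on V N"
  shows "connected_on V M"
  unfolding connected_on_def
proof (intro allI impI, rule ccontr)
  fix R assume R: "R \<subseteq> V \<and> R \<noteq> {} \<and> R \<noteq> V"
    and "\<not> (\<exists>i\<in>R. \<exists>j\<in>V - R. M i j \<noteq> 0)"
  hence "N i j = 0" if "i \<in> R" "j \<in> V - R" for i j
    using inverse_pair_block_zero[OF inverse_pair_swap[OF P], of R "V - R" i j] that by blast
  thus False using C R unfolding connected_on_def by blast
qed

text \<open>The Schur complement of the pivot \<open>N v v\<close>, that is one step of Gaussian elimination.\<close>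
definition schur :: "('a \<Rightarrow> 'a \<Rightarrow> real) \<Rightarrow> 'a \<Rightarrow> 'a \<Rightarrow> 'a \<Rightarrow> real" where
  "schur N v i j = N i j - N i v * N v j / N v v"

text \<open>Eliminating an index from a matrix deletes this index from the inverse.\<close>
lemma inverse_pair_schur:
  assumes P: "inverse_pair V N M" and v: "v \<in> V"
  shows "inverse_pair (V - {v}) (schur N v) M"
proof (rule inverse_pair_swap)
  note D = inverse_pairD[OF P]
  note D' = inverse_pairD[OF inverse_pair_swap[OF P]]
  have vv: "N v v \<noteq> 0" using pos_def_on_diag[OF D(1,5) v] by simp
  have "(\<Sum>k\<in>V - {v}. M i k * schur N v k j) = (if i = j then 1 else 0)"
    if ij: "i \<in> V - {v}" "j \<in> V - {v}" for i j
  proof -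
    have e: "(\<Sum>k\<in>V - {v}. M i k * N k l) = (if i = l then 1 else 0) - M i v * N v l" if "l \<in> V" for l
      using D'(4)[of i l] that ij sum.remove[OF D(1) v, of "\<lambda>k. M i k * N k l"] by auto
    have "(\<Sum>k\<in>V - {v}. M i k * schur N v k j) =
       (\<Sum>k\<in>V - {v}. M i k * N k j) - (\<Sum>k\<in>V - {v}. M i k * N k v) * N v j / N v v"
      by (simp add: schur_def sum_subtractf sum_distrib_right sum_divide_distrib right_diff_distrib mult.assoc)
    also have "\<dots> = (if i = j then 1 else 0)"
      using e[of j] e[of v] ij v vv by auto
    finally show ?thesis .
  qed
  moreover have "sym_on (V - {v}) (schur N v)"
    using D(2) v by (auto simp: sym_on_def schur_def)
  ultimately show "inverse_pair (V - {v}) M (schur N v)"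
    using D D' pos_def_on_subset[of V M "V - {v}"]
    unfolding inverse_pair_def sym_on_def by auto
qed

section \<open>Cut vertices\<close>

text \<open>So \<open>v\<close> is a cut vertex of the graph of \<open>M\<close>.\<close>
definition separates :: "'a \<Rightarrow> 'a set \<Rightarrow> ('a \<Rightarrow> 'a \<Rightarrow> real) \<Rightarrow> 'a set \<Rightarrow> 'a set \<Rightarrow> bool" where
  "separates v V M R S \<longleftrightarrow>
     V = insert v (R \<union> S) \<and> v \<notin> R \<and> v \<notin> S \<and> R \<inter> S = {} \<and> R \<noteq> {} \<and> S \<noteq> {} \<and>
     (\<forall>i\<in>R. \<forall>j\<in>S. M i j = 0)"

lemma separates_swap:
  assumes "inverse_pair V N M" "separates v V M R S"
  shows "separates v V M S R"
proof -
  have "M j i = M i j" if "i \<in> R" "j \<in> S" for i j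
    using inverse_pairD(3)[OF assms(1)] assms(2) that unfolding separates_def by blast
  thus ?thesis using assms(2) unfolding separates_def by auto
qed

text \<open>The matrix \<open>M\<close> without \<open>v\<close> is block diagonal, hence so is its inverse, which is the Schur
  complement of \<open>N\<close> at \<open>v\<close>. In other words, the block of \<open>N\<close> between the two sides has rank at
  most one.\<close>
lemma separates_rank_one:
  assumes P: "inverse_pair V N M" and S: "separates v V M R S" and "i \<in> R" "k \<in> S"
  shows "N i k * N v v = N i v * N v k"
proof -
  note D = inverse_pairD[OF P]
  have v: "v \<in> V" and V: "V - {v} = R \<union> S" using S unfolding separates_def by auto
  have "schur N v i k = 0"
    using inverse_pair_block_zero[OF inverse_pair_swap[OF inverse_pair_schur[OF P v]], of R S i k]
      S V assms(3,4) unfolding separates_def by auto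
  thus ?thesis using pos_def_on_diag[OF D(1,5) v] by (simp add: schur_def field_simps)
qed

text \<open>A pair whose second member has a cut vertex \<open>v\<close> is glued from two pairs of smaller size:
  restricting \<open>N\<close> to one side together with \<open>v\<close> gives a matrix whose inverse is the same
  restriction of \<open>M\<close>, up to the entry at \<open>(v, v)\<close>, and this entry does not affect the graph.\<close>
lemma separates_piece:
  assumes P: "inverse_pair V N M" and S: "separates v V M R S"
  obtains M' where "inverse_pair (insert v R) N M'"
    "\<And>i j. i \<noteq> j \<Longrightarrow> M' i j = M i j"
proof -
  note D = inverse_pairD[OF P]
  note D' = inverse_pairD[OF inverse_pair_swap[OF P]]
  have VS: "V = insert v R \<union> S" "insert v R \<inter> S = {}" "v \<in> V" "v \<notin> R"
    using S unfolding separates_def by auto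
  have fin: "finite (insert v R)" "finite S" using D(1) VS(1) by auto
  have vv: "N v v \<noteq> 0" using pos_def_on_diag[OF D(1,5) VS(3)] by simp
  \<comment> \<open>What the far side \<open>S\<close> contributes to the entries of the product \<open>N M\<close> in column \<open>v\<close> is
    \<open>t\<close> times column \<open>v\<close> of \<open>N\<close>, by the rank one identity.\<close>
  define t where "t = (\<Sum>k\<in>S. N v k * M k v) / N v v"
  define M' where "M' i j = (if i = v \<and> j = v then M v v + t else M i j)" for i j
  have inv: "(\<Sum>k\<in>insert v R. N i k * M' k j) = (if i = j then 1 else 0)"
    if ij: "i \<in> insert v R" "j \<in> insert v R" for i j
  proof -
    have iV: "i \<in> V" "j \<in> V" using ij VS by auto
    have split: "(\<Sum>k\<in>insert v R. N i k * M k j) + (\<Sum>k\<in>S. N i k * M k j) = (if i = j then 1 else 0)"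
      using D(4)[OF iV] sum.union_disjoint[OF fin VS(2), of "\<lambda>k. N i k * M k j"] VS(1) by simp
    show ?thesis
    proof (cases "j = v")
      case False
      hence jR: "j \<in> R" using ij by simp
      have "M k j = 0" if "k \<in> S" for k
        using separates_swap[OF P S] jR that unfolding separates_def by blast
      hence "(\<Sum>k\<in>S. N i k * M k j) = 0" by simp
      moreover have "(\<Sum>k\<in>insert v R. N i k * M' k j) = (\<Sum>k\<in>insert v R. N i k * M k j)"
        using False by (simp add: M'_def)
      ultimately show ?thesis using split by simp
    next
      case True
      have "N i k = N i v * N v k / N v v" if "k \<in> S" for k
        using separates_rank_one[OF P S _ that, of i] ij vv by (cases "i = v") (auto simp: field_simps)
      hence "(\<Sum>k\<in>S. N i k * M k v) = (\<Sum>k\<in>S. N i v * (N v k * M k v) / N v v)"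
        by (intro sum.cong) (auto simp: field_simps)
      also have "\<dots> = N i v * t" by (simp add: t_def sum_distrib_left sum_divide_distrib)
      finally have a: "(\<Sum>k\<in>S. N i k * M k v) = N i v * t" .
      have "(\<Sum>k\<in>insert v R. N i k * M' k v) = N i v * (M v v + t) + (\<Sum>k\<in>R. N i k * M' k v)"
        using fin VS(4) by (simp add: M'_def)
      also have "(\<Sum>k\<in>R. N i k * M' k v) = (\<Sum>k\<in>R. N i k * M k v)"
        using VS(4) by (intro sum.cong) (auto simp: M'_def)
      also have "N i v * (M v v + t) + \<dots> = (\<Sum>k\<in>insert v R. N i k * M k v) + N i v * t"
        using fin VS(4) by (simp add: algebra_simps)
      finally show ?thesis using split a True by simp
    qed
  qed
  have "sym_on (insert v R) N" "sym_on (insert v R) M'"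
    using D(2,3) VS unfolding sym_on_def M'_def by auto
  hence "inverse_pair (insert v R) N M'"
    using inv fin pos_def_on_subset[OF D(1,5), of "insert v R"] VS(1)
    unfolding inverse_pair_def by auto
  thus thesis by (rule that) (auto simp: M'_def)
qed

section \<open>Counting edges\<close>

lemma arcs_on_cong:
  assumes "\<And>i j. i \<in> V \<Longrightarrow> j \<in> V \<Longrightarrow> i \<noteq> j \<Longrightarrow> (N i j \<noteq> 0) = (N' i j \<noteq> 0)"
  shows "arcs_on V N = arcs_on V N'"
  using assms by (auto simp: arcs_on_def nbrs_def)

lemma finite_arcs_on: "finite V \<Longrightarrow> finite (arcs_on V N)"
  by (auto simp: arcs_on_def nbrs_def)

lemma card_arcs_on: "finite V \<Longrightarrow> card (arcs_on V N) = (\<Sum>i\<in>V. card (nbrs V N i))"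
  unfolding arcs_on_def by (rule card_SigmaI) (auto simp: nbrs_def)

lemma card_arcs_on_remove:
  assumes "finite V" "sym_on V N" "v \<in> V"
  shows "card (arcs_on V N) = card (arcs_on (V - {v}) N) + 2 * card (nbrs V N v)"
proof -
  let ?A = "Pair v ` nbrs V N v" and ?B = "(\<lambda>j. (j, v)) ` nbrs V N v"
  have eq: "arcs_on V N = arcs_on (V - {v}) N \<union> (?A \<union> ?B)"
    using assms by (auto simp: arcs_on_def nbrs_def sym_on_def)
  have f: "finite (nbrs V N v)" using assms(1) by (simp add: nbrs_def)
  have "card (arcs_on V N) = card (arcs_on (V - {v}) N) + card (?A \<union> ?B)"
    unfolding eq using assms(1) f
    by (intro card_Un_disjoint finite_arcs_on) (auto simp: arcs_on_def nbrs_def)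
  also have "card (?A \<union> ?B) = card ?A + card ?B"
    using f by (intro card_Un_disjoint) (auto simp: nbrs_def)
  finally show ?thesis by (simp add: card_image inj_on_def)
qed

lemma connected_on_nbrs:
  assumes "connected_on V N" "v \<in> V" "V \<noteq> {v}"
  shows "nbrs V N v \<noteq> {}"
proof -
  have "\<exists>i\<in>{v}. \<exists>j\<in>V - {v}. N i j \<noteq> 0"
    using assms unfolding connected_on_def by blast
  thus ?thesis by (auto simp: nbrs_def)
qed

text \<open>The two glued pieces have \<open>card V + 1\<close> indices in total, so the bounds for them add up to
  \<open>6 * card V + 6 - 16\<close>, two short of the bound for the whole. The two missing arcs join
  the sides: by the rank one identity a neighbour \<open>a\<close> of \<open>v\<close> on one side is adjacent in \<open>N\<close> to
  every neighbour \<open>b\<close> of \<open>v\<close> on the other.\<close>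
lemma separates_arc_step:
  fixes V :: "'a set"
  assumes P: "inverse_pair V N M" and C: "connected_on V N" and S: "separates v V M R S"
    and IH: "\<And>(W :: 'a set) N' M'. card W < card V \<Longrightarrow> inverse_pair W N' M' \<Longrightarrow> connected_on W N' \<Longrightarrow> W \<noteq> {} \<Longrightarrow>
      6 * card W \<le> card (arcs_on W N') + card (arcs_on W M') + (8::nat)"
  shows "6 * card V \<le> card (arcs_on V N) + card (arcs_on V M) + 8"
proof -
  note D = inverse_pairD[OF P]
  have CM: "connected_on V M" using inverse_pair_connected[OF P C] .
  have piece: "6 * card (insert v A) \<le> card (arcs_on (insert v A) N) + card (arcs_on (insert v A) M) + 8"
    if AB: "separates v V M A B" for A B
  proof -
    obtain M' where P': "inverse_pair (insert v A) N M'" and M': "\<And>i j. i \<noteq> j \<Longrightarrow> M' i j = M i j"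
      using separates_piece[OF P AB] by blast
    have V: "V = insert v A \<union> B" "insert v A \<inter> B = {}" "B \<noteq> {}" "v \<notin> A"
      using AB unfolding separates_def by auto
    have lt: "card (insert v A) < card V" using V D(1) by (intro psubset_card_mono) auto
    have "connected_on (insert v A) M'"
      unfolding connected_on_def
    proof (intro allI impI, rule ccontr)
      fix X assume X: "X \<subseteq> insert v A \<and> X \<noteq> {} \<and> X \<noteq> insert v A"
        and nz: "\<not> (\<exists>i\<in>X. \<exists>j\<in>insert v A - X. M' i j \<noteq> 0)"
      \<comment> \<open>Of the two parts \<open>X\<close> and \<open>insert v A - X\<close>, the one without \<open>v\<close> lies in \<open>A\<close> and so
        has no neighbour in \<open>B\<close> either; it would be cut off in all of \<open>V\<close>.\<close>
      have z: "M i j = 0" "M j i = 0" if "i \<in> X" "j \<in> insert v A - X" for i j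
        using nz that M'[of i j] D(3)[of j i] X V(1) by fastforce+
      have zB: "M i j = 0" "M j i = 0" if "i \<in> A" "j \<in> B" for i j
        using AB separates_swap[OF P AB] that unfolding separates_def by auto
      have "\<exists>Y. Y \<subseteq> V \<and> Y \<noteq> {} \<and> Y \<noteq> V \<and> (\<forall>i\<in>Y. \<forall>j\<in>V - Y. M i j = 0)"
      proof (cases "v \<in> X")
        case True
        show ?thesis
          by (rule exI[of _ "insert v A - X"]) (use True X V z zB in auto)
      next
        case False
        show ?thesis
          by (rule exI[of _ X]) (use False X V z zB in auto)
      qed
      thus False using CM unfolding connected_on_def by blast
    qed
    hence "connected_on (insert v A) N" using inverse_pair_connected[OF inverse_pair_swap[OF P']] by blast
    from IH[OF lt P' this] have "6 * card (insert v A) \<le> card (arcs_on (insert v A) N) + card (arcs_on (insert v A) M') + 8"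
      by simp
    also have "arcs_on (insert v A) M' = arcs_on (insert v A) M" using M' by (intro arcs_on_cong) auto
    finally show ?thesis .
  qed
  have V: "V = insert v (R \<union> S)" "v \<notin> R" "v \<notin> S" "R \<inter> S = {}" "R \<noteq> {}" "S \<noteq> {}"
    using S unfolding separates_def by auto
  have fin: "finite R" "finite S" using D(1) V(1) by auto
  have vv: "N v v \<noteq> 0" using pos_def_on_diag[OF D(1,5), of v] V(1) by simp
  have ex: "\<exists>a\<in>A. N a v \<noteq> 0" if AB: "separates v V M A B" for A B
  proof (rule ccontr)
    assume n: "\<not> ?thesis"
    have V': "V = insert v (A \<union> B)" "v \<notin> A" "A \<inter> B = {}" "A \<noteq> {}"
      using AB unfolding separates_def by auto
    have "N i j = 0" if "i \<in> A" "j \<in> V - A" for i j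
      using separates_rank_one[OF P AB that(1), of j] that n V' vv by auto
    thus False using C V' unfolding connected_on_def by blast
  qed
  obtain a where a: "a \<in> R" "N a v \<noteq> 0" using ex[OF S] by blast
  obtain b where b: "b \<in> S" "N b v \<noteq> 0" using ex[OF separates_swap[OF P S]] by blast
  have ab: "N a b \<noteq> 0" "N b a \<noteq> 0"
    using separates_rank_one[OF P S a(1) b(1)] a b D(2)[of b v] D(2)[of a b] V(1) by auto
  have "a \<noteq> b" using a(1) b(1) V(4) by blast
  have un: "card (arcs_on (insert v R) X) + card (arcs_on (insert v S) X) =
      card (arcs_on (insert v R) X \<union> arcs_on (insert v S) X)" for X :: "'a \<Rightarrow> 'a \<Rightarrow> real"
    using fin V by (intro card_Un_disjoint[symmetric] finite_arcs_on) (auto simp: arcs_on_def nbrs_def)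
  have m: "card (arcs_on (insert v R) M) + card (arcs_on (insert v S) M) \<le> card (arcs_on V M)"
    unfolding un using V(1) D(1) by (intro card_mono finite_arcs_on) (auto simp: arcs_on_def nbrs_def)
  have "card (arcs_on (insert v R) N) + card (arcs_on (insert v S) N) + 2 =
     card (arcs_on (insert v R) N \<union> arcs_on (insert v S) N) + card {(a,b),(b,a)}"
    unfolding un using \<open>a \<noteq> b\<close> by simp
  also have "\<dots> = card ((arcs_on (insert v R) N \<union> arcs_on (insert v S) N) \<union> {(a,b),(b,a)})"
    using fin a b V by (intro card_Un_disjoint[symmetric] finite_UnI finite_arcs_on) (auto simp: arcs_on_def nbrs_def)
  also have "\<dots> \<le> card (arcs_on V N)"
    using V(1,4) D(1) a b ab by (intro card_mono finite_arcs_on) (auto simp: arcs_on_def nbrs_def)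
  finally have n: "card (arcs_on (insert v R) N) + card (arcs_on (insert v S) N) + 2 \<le> card (arcs_on V N)" .
  have "card (insert v R) + card (insert v S) = card V + 1"
    using fin V by (simp add: card_Un_disjoint)
  thus ?thesis using m n piece[OF S] piece[OF separates_swap[OF P S]] by linarith
qed

text \<open>The only neighbour of a leaf would be a cut vertex.\<close>
lemma degree_ge_2:
  assumes P: "inverse_pair V N M" and C: "connected_on V M" and n: "card V \<ge> 3"
    and nosep: "\<And>v R S. \<not> separates v V M R S" and v: "v \<in> V"
  shows "card (nbrs V M v) \<ge> 2"
proof (rule ccontr)
  note D = inverse_pairD[OF P]
  assume "\<not> ?thesis"
  moreover have "V \<noteq> {v}" using n by auto
  hence "nbrs V M v \<noteq> {}" by (rule connected_on_nbrs[OF C v])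
  moreover have "finite (nbrs V M v)" using D(1) by (simp add: nbrs_def)
  ultimately have "card (nbrs V M v) = 1" by (metis Suc_1 card_0_eq less_2_cases not_le One_nat_def)
  then obtain u where u: "nbrs V M v = {u}" by (auto simp: card_Suc_eq)
  hence uv: "u \<in> V" "u \<noteq> v" by (auto simp: nbrs_def)
  have "V - {u, v} \<noteq> {}"
  proof
    assume "V - {u, v} = {}"
    hence "card V \<le> card {u, v}" by (intro card_mono) auto
    also have "\<dots> \<le> 2" by (simp add: card_insert_if)
    finally show False using n by simp
  qed
  hence "separates u V M {v} (V - {u, v})"
    using u uv v unfolding separates_def by (auto simp: nbrs_def)
  thus False using nosep by blast
qed

text \<open>Eliminate a vertex \<open>v\<close> with exactly two neighbours in \<open>N\<close>. The graph of \<open>N\<close> loses two edges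
  and gains at most one, between the two neighbours; the graph of \<open>M\<close> just loses \<open>v\<close>
  and with it at least two edges. The total drops by at least three edges, the bound by exactly three. Since \<open>v\<close> is
  not a cut vertex of \<open>M\<close>, the smaller pair is connected again.\<close>
lemma degree_two_arc_step:
  fixes V :: "'a set"
  assumes P: "inverse_pair V N M" and C: "connected_on V N" and n: "card V \<ge> 3"
    and nosep: "\<And>v R S. \<not> separates v V M R S" "\<And>v R S. \<not> separates v V N R S"
    and v: "v \<in> V" "card (nbrs V N v) \<le> 2"
    and IH: "\<And>(W :: 'a set) N' M'. card W < card V \<Longrightarrow> inverse_pair W N' M' \<Longrightarrow> connected_on W N' \<Longrightarrow> W \<noteq> {} \<Longrightarrow>
      6 * card W \<le> card (arcs_on W N') + card (arcs_on W M') + (8::nat)"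
  shows "6 * card V \<le> card (arcs_on V N) + card (arcs_on V M) + 8"
proof -
  note D = inverse_pairD[OF P]
  have CM: "connected_on V M" using inverse_pair_connected[OF P C] .
  have dM: "card (nbrs V M v) \<ge> 2" using degree_ge_2[OF P CM n nosep(1) v(1)] .
  have dN: "card (nbrs V N v) = 2"
    using degree_ge_2[OF inverse_pair_swap[OF P] C n nosep(2) v(1)] v(2) by simp
  then obtain a b where ab: "nbrs V N v = {a, b}" "a \<noteq> b" by (auto simp: card_2_iff)
  let ?W = "V - {v}"
  have P': "inverse_pair ?W (schur N v) M" using inverse_pair_schur[OF P v(1)] .
  have "connected_on ?W M"
    unfolding connected_on_def
  proof (intro allI impI, rule ccontr)
    fix R assume R: "R \<subseteq> ?W \<and> R \<noteq> {} \<and> R \<noteq> ?W" and "\<not> (\<exists>i\<in>R. \<exists>j\<in>?W - R. M i j \<noteq> 0)"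
    hence "separates v V M R (?W - R)" using v(1) unfolding separates_def by auto
    thus False using nosep(1) by blast
  qed
  hence C': "connected_on ?W (schur N v)"
    using inverse_pair_connected[OF inverse_pair_swap[OF P']] by blast
  have cW: "card V = card ?W + 1" using v(1) D(1) n by simp
  have "?W \<noteq> {}" using cW n by force
  hence I: "6 * card ?W \<le> card (arcs_on ?W (schur N v)) + card (arcs_on ?W M) + 8"
    using IH[OF _ P' C'] cW by simp
  have "card (arcs_on ?W (schur N v)) \<le> card (arcs_on ?W N \<union> {(a,b),(b,a)})"
  proof (intro card_mono finite_UnI finite_arcs_on)
    show "arcs_on ?W (schur N v) \<subseteq> arcs_on ?W N \<union> {(a,b),(b,a)}"
    proof (intro subsetI)
      fix e assume "e \<in> arcs_on ?W (schur N v)"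
      then obtain i j where e: "e = (i, j)" "i \<in> ?W" "j \<in> ?W" "i \<noteq> j" "schur N v i j \<noteq> 0"
        by (auto simp: arcs_on_def nbrs_def)
      show "e \<in> arcs_on ?W N \<union> {(a,b),(b,a)}"
      proof (cases "N i j = 0")
        case True
        hence "N v i \<noteq> 0" "N v j \<noteq> 0" using e D(2)[of i v] v(1) by (auto simp: schur_def)
        hence "i \<in> {a, b}" "j \<in> {a, b}" using e ab(1) by (auto simp: nbrs_def)
        thus ?thesis using e by auto
      qed (use e in \<open>auto simp: arcs_on_def nbrs_def\<close>)
    qed
  qed (use D(1) in auto)
  also have "\<dots> \<le> card (arcs_on ?W N) + card {(a,b),(b,a)}" by (rule card_Un_le)
  also have "card {(a,b),(b,a)} = 2" using ab(2) by simp
  finally have F: "card (arcs_on ?W (schur N v)) \<le> card (arcs_on ?W N) + 2" .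
  have sy: "sym_on V N" "sym_on V M" using P unfolding inverse_pair_def by auto
  show ?thesis
    using I F cW dM dN card_arcs_on_remove[OF D(1) sy(1) v(1)] card_arcs_on_remove[OF D(1) sy(2) v(1)]
    by linarith
qed

text \<open>In terms of edges: the graphs of a connected positive definite matrix of size \<open>n\<close> and of its
  inverse have at least \<open>3 n - 4\<close> edges together. Once cut vertices and vertices of degree two are
  dealt with by induction, all degrees are at least three, and then there are even \<open>3 n\<close> edges.\<close>
theorem inverse_pair_arcs:
  fixes V :: "'a set"
  assumes "inverse_pair V N M" "connected_on V N" "V \<noteq> {}"
  shows "6 * card V \<le> card (arcs_on V N) + card (arcs_on V M) + 8"
  using assms
proof (induction "card V" arbitrary: V N M rule: less_induct)
  case less
  note P = less.prems(1) and C = less.prems(2)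
  note P' = inverse_pair_swap[OF P] and C' = inverse_pair_connected[OF P C]
  have fin: "finite V" using inverse_pairD(1)[OF P] .
  have IH: "6 * card W \<le> card (arcs_on W N') + card (arcs_on W M') + 8"
    if "card W < card V" "inverse_pair W N' M'" "connected_on W N'" "W \<noteq> {}" for W :: "'a set" and N' M'
    using less.hyps[OF that] .
  have deg1: "card V \<le> card (arcs_on V X)" if "connected_on V X" "card V \<ge> 2" for X
  proof -
    have "card (nbrs V X i) \<ge> 1" if i: "i \<in> V" for i
    proof -
      have "V \<noteq> {i}" using \<open>card V \<ge> 2\<close> by auto
      thus ?thesis using connected_on_nbrs[OF \<open>connected_on V X\<close> i] fin
        by (simp add: Suc_le_eq card_gt_0_iff nbrs_def)
    qed
    hence "(\<Sum>i\<in>V. 1) \<le> (\<Sum>i\<in>V. card (nbrs V X i))" by (intro sum_mono)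
    thus ?thesis using card_arcs_on[OF fin, of X] by simp
  qed
  have "card V \<le> 1 \<or> card V = 2 \<or> card V \<ge> 3" by linarith
  then consider "card V \<le> 1" | "card V = 2"
    | v R S where "separates v V M R S"
    | v R S where "separates v V N R S"
    | "card V \<ge> 3" "\<And>v R S. \<not> separates v V M R S" "\<And>v R S. \<not> separates v V N R S"
    by blast
  thus ?case
  proof cases
    case 1
    thus ?thesis by simp
  next
    case 2
    thus ?thesis using deg1[OF C] deg1[OF C'] by simp
  next
    case 3
    thus ?thesis using separates_arc_step[OF P C _ IH] by blast
  next
    case 4
    thus ?thesis using separates_arc_step[OF P' C' _ IH] by (simp add: add_ac)
  next
    case 5
    consider v where "v \<in> V" "card (nbrs V N v) \<le> 2" | v where "v \<in> V" "card (nbrs V M v) \<le> 2"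
      | "\<forall>v\<in>V. card (nbrs V N v) \<ge> 3 \<and> card (nbrs V M v) \<ge> 3" by force
    thus ?thesis
    proof cases
      case (1 v)
      show ?thesis using degree_two_arc_step[OF P C 5(1,2,3) 1 IH] .
    next
      case (2 v)
      show ?thesis using degree_two_arc_step[OF P' C' 5(1,3,2) 2 IH] by (simp add: add_ac)
    next
      case 3
      hence "(\<Sum>i\<in>V. 6) \<le> (\<Sum>i\<in>V. card (nbrs V N i) + card (nbrs V M i))"
        by (intro sum_mono) fastforce
      thus ?thesis by (simp add: card_arcs_on[OF fin] sum.distrib)
    qed
  qed
qed


section \<open>Matrices, irreducibility and graphs\<close>
abbreviation (input) entries :: "real mat \<Rightarrow> nat \<Rightarrow> nat \<Rightarrow> real" where
  "entries A \<equiv> \<lambda>i j. A $$ (i, j)"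

lemma sym_on_entries:
  assumes "A \<in> carrier_mat n n" "transpose_mat A = A"
  shows "sym_on {..<n} (entries A)"
  unfolding sym_on_def using assms index_transpose_mat(1)[of _ A] by (metis carrier_matD lessThan_iff)

lemma pos_def_on_entries:
  assumes "A \<in> carrier_mat n n" "pos_def_mat A"
  shows "pos_def_on {..<n} (entries A)"
  unfolding pos_def_on_def
proof (intro allI impI)
  fix x :: "nat \<Rightarrow> real" assume "\<exists>i\<in>{..<n}. x i \<noteq> 0"
  then obtain i where i: "i < n" "x i \<noteq> 0" by auto
  have "vec n x \<noteq> 0\<^sub>v n"
  proof
    assume "vec n x = 0\<^sub>v n"
    hence "vec n x $ i = 0\<^sub>v n $ i" by simp
    thus False using i by simp
  qed
  hence "vec n x \<bullet> (A *\<^sub>v vec n x) > 0"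
    using assms unfolding pos_def_mat_def by auto
  also have "vec n x \<bullet> (A *\<^sub>v vec n x) = (\<Sum>i<n. \<Sum>j<n. x i * A $$ (i, j) * x j)"
    using assms(1) by (auto simp: scalar_prod_def sum_distrib_left mult.assoc lessThan_atLeast0 intro!: sum.cong)
  finally show "(\<Sum>i<n. \<Sum>j<n. x i * A $$ (i, j) * x j) > 0" .
qed

lemma pos_def_mat_gram:
  assumes K: "K \<in> carrier_mat n n" and K': "K' \<in> carrier_mat n n" and inv: "K' * K = 1\<^sub>m n"
  shows "pos_def_mat (transpose_mat K * K)"
  unfolding pos_def_mat_def
proof (intro conjI ballI impI)
  show "square_mat (transpose_mat K * K)" using K by simp
  show "transpose_mat (transpose_mat K * K) = transpose_mat K * K"
    using transpose_mult[of "transpose_mat K" n n K n] K by simp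
  fix x :: "real vec"
  assume "x \<in> carrier_vec (dim_row (transpose_mat K * K))" and nz: "x \<noteq> 0\<^sub>v (dim_row (transpose_mat K * K))"
  hence x: "x \<in> carrier_vec n" "x \<noteq> 0\<^sub>v n" using K by auto
  let ?y = "K *\<^sub>v x"
  have y: "?y \<in> carrier_vec n" using K x by simp
  have "x \<bullet> ((transpose_mat K * K) *\<^sub>v x) = x \<bullet> (transpose_mat K *\<^sub>v ?y)"
    using K x by (subst assoc_mult_mat_vec[of _ n n _ n]) auto
  also have "\<dots> = (transpose_mat K *\<^sub>v ?y) \<bullet> x"
    using K x y by (intro comm_scalar_prod[of _ n]) auto
  also have "\<dots> = ?y \<bullet> ?y" using transpose_vec_mult_scalar[OF K x(1) y] .
  also have "\<dots> = (\<Sum>i<n. (?y $ i)\<^sup>2)"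
    using K by (simp add: scalar_prod_def power2_eq_square lessThan_atLeast0)
  also have "\<dots> > 0"
  proof (rule ccontr)
    assume "\<not> ?thesis"
    hence "(\<Sum>i<n. (?y $ i)\<^sup>2) = 0" by (meson linorder_not_less order_antisym sum_nonneg zero_le_power2)
    hence "?y $ i = 0" if "i < n" for i
      using that by (subst (asm) sum_nonneg_eq_0_iff) auto
    hence "?y = 0\<^sub>v n" using K by (intro eq_vecI) auto
    hence "K' *\<^sub>v ?y = 0\<^sub>v n" using K' by auto
    moreover have "K' *\<^sub>v ?y = x"
      using assoc_mult_mat_vec[OF K' K x(1)] inv x(1) by simp
    ultimately show False using x(2) by simp
  qed
  finally show "x \<bullet> ((transpose_mat K * K) *\<^sub>v x) > 0" .
qed

lemma connected_mat_graph_iff: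
  assumes A: "A \<in> carrier_mat n n" "transpose_mat A = A" and n: "n > 0"
  shows "Digraph_Component.connected (with_proj (mat_graph A)) \<longleftrightarrow> connected_on {..<n} (entries A)"
proof -
  define E where "E = {(i, j). i < n \<and> j < n \<and> i \<noteq> j \<and> A $$ (i, j) \<noteq> 0}"
  have sym: "A $$ (i, j) = A $$ (j, i)" if "i < n" "j < n" for i j
    using sym_on_entries[OF A] that unfolding sym_on_def by simp
  have vE: "parcs (mk_symmetric (with_proj (mat_graph A))) = E"
    using A sym by (auto simp: parcs_mk_symmetric mat_graph_def E_def)
  have "Digraph_Component.connected (with_proj (mat_graph A)) \<longleftrightarrow>
      (\<forall>u<n. \<forall>w<n. (u, w) \<in> rtrancl_on {..<n} E)"
    using A n unfolding Digraph_Component.connected_def strongly_connected_def reachable_def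
    by (auto simp: vE) (auto simp: mat_graph_def)
  also have "\<dots> \<longleftrightarrow> connected_on {..<n} (entries A)"
  proof
    assume reach: "\<forall>u<n. \<forall>w<n. (u, w) \<in> rtrancl_on {..<n} E"
    show "connected_on {..<n} (entries A)"
      unfolding connected_on_def
    proof (intro allI impI, rule ccontr)
      fix R assume R: "R \<subseteq> {..<n} \<and> R \<noteq> {} \<and> R \<noteq> {..<n}"
        and no: "\<not> (\<exists>i\<in>R. \<exists>j\<in>{..<n} - R. A $$ (i, j) \<noteq> 0)"
      from R obtain u w where uw: "u \<in> R" "w < n" "w \<notin> R" "u < n" by blast
      have "w \<in> R" if "(u, w) \<in> rtrancl_on {..<n} E" for w
        using that
      proof (induction rule: rtrancl_on_induct)
        case base
        show ?case using uw by simp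
      next
        case (step y z)
        thus ?case using no by (auto simp: E_def)
      qed
      thus False using reach uw by blast
    qed
  next
    assume C: "connected_on {..<n} (entries A)"
    show "\<forall>u<n. \<forall>w<n. (u, w) \<in> rtrancl_on {..<n} E"
    proof (intro allI impI, rule ccontr)
      fix u w assume u: "u < n" and w: "w < n" "(u, w) \<notin> rtrancl_on {..<n} E"
      let ?R = "{w. (u, w) \<in> rtrancl_on {..<n} E}"
      have "?R \<subseteq> {..<n}" using in_rtrancl_on_in_F[of u _ "{..<n}" E] by auto
      moreover have "u \<in> ?R" using u by simp
      moreover have "?R \<noteq> {..<n}" using w by auto
      ultimately obtain i j where ij: "i \<in> ?R" "j \<in> {..<n} - ?R" "A $$ (i, j) \<noteq> 0"
        using C unfolding connected_on_def by blast
      have "i < n" using ij(1) \<open>?R \<subseteq> {..<n}\<close> by auto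
      hence "(i, j) \<in> E" using ij by (auto simp: E_def)
      hence "j \<in> ?R" using ij rtrancl_on_into_rtrancl_on[of u i "{..<n}" E j] by auto
      thus False using ij by simp
    qed
  qed
  finally show ?thesis .
qed

lemma permutation_conjugate_entry:
  fixes A :: "real mat"
  assumes A: "A \<in> carrier_mat n n" and s: "\<sigma> permutes {..<n}"
    and P: "P = mat n n (\<lambda>(i, j). if j = \<sigma> i then 1 else 0)" and ij: "i < n" "j < n"
  shows "(P * A * transpose_mat P) $$ (i, j) = A $$ (\<sigma> i, \<sigma> j)"
proof -
  have lt: "\<sigma> k < n" if "k < n" for k using permutes_in_image[OF s, of k] that by simp
  have PA: "(P * A) $$ (i, k) = A $$ (\<sigma> i, k)" if "k < n" for k
  proof -
    have "(P * A) $$ (i, k) = (\<Sum>l<n. (if l = \<sigma> i then 1 else 0) * A $$ (l, k))"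
      using A ij that by (simp add: P scalar_prod_def lessThan_atLeast0)
    also have "\<dots> = (\<Sum>l<n. if l = \<sigma> i then A $$ (l, k) else 0)"
      by (intro sum.cong) auto
    also have "\<dots> = A $$ (\<sigma> i, k)" using lt[OF ij(1)] by simp
    finally show ?thesis .
  qed
  have "(P * A * transpose_mat P) $$ (i, j) = row (P * A) i \<bullet> col (transpose_mat P) j"
    using A ij by (intro index_mult_mat(1)) (simp_all add: P)
  also have "\<dots> = (\<Sum>k<n. (P * A) $$ (i, k) * (if k = \<sigma> j then 1 else 0))"
    using A ij unfolding scalar_prod_def by (intro sum.cong) (auto simp: P)
  also have "\<dots> = (\<Sum>k<n. if k = \<sigma> j then A $$ (\<sigma> i, k) else 0)"
    using PA by (intro sum.cong) auto
  also have "\<dots> = A $$ (\<sigma> i, \<sigma> j)" using lt[OF ij(2)] by simp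
  finally show ?thesis .
qed

text \<open>The first diagonal block of a block triangular form marks a set of indices that is joined to
  the others by zeros, on both sides of the diagonal because of the symmetry. Conversely, any
  permutation that lists such a set first exhibits two diagonal blocks.\<close>
lemma irreducible_mat_iff_connected_on:
  assumes A: "A \<in> carrier_mat n n" "transpose_mat A = A"
  shows "irreducible_mat A \<longleftrightarrow> connected_on {..<n} (entries A)"
proof -
  have sq: "square_mat A" and dim: "dim_row A = n" using A by auto
  have sym: "A $$ (i, j) = A $$ (j, i)" if "i < n" "j < n" for i j
    using sym_on_entries[OF A] that unfolding sym_on_def by simp
  have "reducible_mat A \<longleftrightarrow> \<not> connected_on {..<n} (entries A)"
  proof
    assume "reducible_mat A"
    then obtain P ks \<sigma> where s: "\<sigma> permutes {..<n}"
      and P: "P = mat n n (\<lambda>(i, j). if j = \<sigma> i then 1 else 0)"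
      and ks: "length ks \<ge> 2" "\<forall>k\<in>set ks. k > 0"
      and b: "block_upper_triangular ks (P * A * transpose_mat P)"
      unfolding reducible_mat_def permutation_mat_def dim by blast
    obtain k k' ks' where kk: "ks = k # k' # ks'"
      using ks(1) by (metis Suc_le_length_iff numeral_2_eq_2)
    have n: "sum_list ks = n"
      using b unfolding block_upper_triangular_def by (auto simp: P)
    have k: "0 < k" "k < n" using ks(2) n kk by auto
    have z: "A $$ (\<sigma> i, \<sigma> j) = 0" if "k \<le> i" "i < n" "j < k" for i j
    proof -
      have "(P * A * transpose_mat P) $$ (i, j) = 0"
        using b that n unfolding block_upper_triangular_def kk by (auto dest: spec[of _ 1])
      thus ?thesis using permutation_conjugate_entry[OF A(1) s P, of i j] that k by simp
    qed
    let ?R = "\<sigma> ` {..<k}"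
    have im: "\<sigma> ` {..<n} = {..<n}" using permutes_image[OF s] .
    have inj: "inj \<sigma>" using permutes_inj[OF s] .
    have sub: "?R \<subseteq> {..<n}" using im k by auto
    have ne: "?R \<noteq> {}" using k by auto
    have proper: "?R \<noteq> {..<n}"
    proof
      assume "?R = {..<n}"
      hence "card {..<n} = card {..<k}" using card_image[OF inj_on_subset[OF inj], of "{..<k}"] by simp
      thus False using k by simp
    qed
    have zero: "A $$ (i, j) = 0" if ij: "i \<in> ?R" "j \<in> {..<n} - ?R" for i j
    proof -
      obtain i' where i': "i = \<sigma> i'" "i' < k" using ij by auto
      have "j \<in> \<sigma> ` {..<n}" using im ij by blast
      then obtain j' where j': "j = \<sigma> j'" "j' < n" by auto
      have "k \<le> j'" using j' ij(2) by (meson DiffD2 image_eqI lessThan_iff not_le)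
      hence "A $$ (j, i) = 0" using z[of j' i'] i' j' by simp
      moreover have "i < n" using ij(1) sub by auto
      ultimately show ?thesis using sym[of i j] ij(2) by simp
    qed
    show "\<not> connected_on {..<n} (entries A)"
    proof
      assume "connected_on {..<n} (entries A)"
      from connected_onD[OF this sub ne proper] show False using zero by simp
    qed
  next
    assume "\<not> connected_on {..<n} (entries A)"
    then obtain R where R: "R \<subseteq> {..<n}" "R \<noteq> {}" "R \<noteq> {..<n}"
      and z: "\<And>i j. i \<in> R \<Longrightarrow> j \<in> {..<n} - R \<Longrightarrow> A $$ (i, j) = 0"
      unfolding connected_on_def by blast
    define r where "r = card R"
    have fR: "finite R" using R(1) finite_subset by blast
    have r: "0 < r" "r < n"
      using R fR psubset_card_mono[of "{..<n}" R] by (auto simp: r_def card_gt_0_iff)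
    obtain f where f: "bij_betw f {..<r} R"
      using finite_same_card_bij[of "{..<r}" R] fR by (auto simp: r_def)
    have "card {r..<n} = card ({..<n} - R)" using R(1) fR by (simp add: card_Diff_subset r_def)
    then obtain g where g: "bij_betw g {r..<n} ({..<n} - R)"
      using finite_same_card_bij[of "{r..<n}" "{..<n} - R"] by auto
    define \<sigma> where "\<sigma> i = (if i < r then f i else if i < n then g i else i)" for i
    have "bij_betw \<sigma> {..<r} R" using f by (rule bij_betw_cong[THEN iffD1, rotated]) (auto simp: \<sigma>_def)
    moreover have "bij_betw \<sigma> {r..<n} ({..<n} - R)"
      using g by (rule bij_betw_cong[THEN iffD1, rotated]) (auto simp: \<sigma>_def)
    ultimately have "bij_betw \<sigma> ({..<r} \<union> {r..<n}) (R \<union> ({..<n} - R))"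
      by (rule bij_betw_combine) auto
    moreover have "{..<r} \<union> {r..<n} = {..<n}" "R \<union> ({..<n} - R) = {..<n}" using r R(1) by auto
    ultimately have s: "\<sigma> permutes {..<n}"
      using r by (intro bij_imp_permutes) (auto simp: \<sigma>_def)
    define P :: "real mat" where "P = mat n n (\<lambda>(i, j). if j = \<sigma> i then 1 else 0)"
    have PC: "P \<in> carrier_mat n n" by (simp add: P_def)
    have "block_upper_triangular [r, n - r] (P * A * transpose_mat P)"
      unfolding block_upper_triangular_def
    proof (intro conjI allI impI)
      show "P * A * transpose_mat P \<in> carrier_mat (sum_list [r, n - r]) (sum_list [r, n - r])"
        using r mult_carrier_mat[OF mult_carrier_mat[OF PC A(1)], of "transpose_mat P" n] PC by simp
      fix a i j assume a: "a < length [r, n - r]" "i < sum_list [r, n - r]"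
        "j < sum_list (take a [r, n - r])" "sum_list (take a [r, n - r]) \<le> i"
      have "a = 1" using a by (cases a) auto
      hence ij: "j < r" "r \<le> i" "i < n" using a r by auto
      have "\<sigma> i \<in> {..<n} - R" "\<sigma> j \<in> R"
        using ij bij_betwE[OF f] bij_betwE[OF g] by (simp_all add: \<sigma>_def)
      hence "A $$ (\<sigma> i, \<sigma> j) = 0" using z[of "\<sigma> j" "\<sigma> i"] sym[of "\<sigma> i" "\<sigma> j"] R(1) by auto
      thus "(P * A * transpose_mat P) $$ (i, j) = 0"
        using permutation_conjugate_entry[OF A(1) s P_def, of i j] ij by simp
    qed
    thus "reducible_mat A"
      unfolding reducible_mat_def permutation_mat_def dim using sq r s P_def
      by (intro conjI exI[of _ P] exI[of _ "[r, n - r]"] exI[of _ \<sigma>]) auto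
  qed
  thus ?thesis using sq unfolding irreducible_mat_def by blast
qed

lemma parcs_mat_graph: "A \<in> carrier_mat n n \<Longrightarrow> parcs (mat_graph A) = arcs_on {..<n} (entries A)"
  by (auto simp: mat_graph_def arcs_on_def nbrs_def)

lemma card_unordered_pairs:
  fixes E :: "('a :: linorder \<times> 'a) set"
  assumes "finite E" "sym E" "irrefl E"
  shows "card E = 2 * card ((\<lambda>(u, v). {u, v}) ` E)"
proof -
  let ?U = "{(u, v) \<in> E. u < v}"
  have E: "E = ?U \<union> prod.swap ` ?U"
  proof (intro equalityI subsetI)
    fix e assume e: "e \<in> E"
    obtain u v where uv: "e = (u, v)" by (cases e)
    have "u \<noteq> v" using e uv assms(3) by (auto simp: irrefl_def)
    hence "u < v \<or> v < u" by auto
    moreover have "(v, u) \<in> E" using e uv assms(2) by (auto dest: symD)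
    ultimately show "e \<in> ?U \<union> prod.swap ` ?U" using e uv by force
  qed (use assms(2) in \<open>auto dest: symD\<close>)
  have "card E = card ?U + card (prod.swap ` ?U)"
    using assms(1) by (subst E, intro card_Un_disjoint) (auto intro: finite_subset)
  moreover have "card (prod.swap ` ?U) = card ?U" by (rule card_image) (auto simp: inj_on_def)
  moreover have "(\<lambda>(u, v). {u, v}) ` E = (\<lambda>(u, v). {u, v}) ` ?U"
    by (subst E) (auto simp: image_Un image_image insert_commute)
  moreover have "card ((\<lambda>(u, v). {u, v}) ` ?U) = card ?U"
    by (rule card_image) (auto simp: inj_on_def doubleton_eq_iff)
  ultimately show ?thesis by simp
qed

lemma card_graph_edges:
  assumes "A \<in> carrier_mat n n" "transpose_mat A = A"
  shows "2 * card (graph_edges (mat_graph A)) = card (arcs_on {..<n} (entries A))"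
proof -
  have "sym (arcs_on {..<n} (entries A))"
    using sym_on_entries[OF assms] by (auto simp: sym_def sym_on_def arcs_on_def nbrs_def)
  moreover have "irrefl (arcs_on {..<n} (entries A))"
    by (auto simp: irrefl_def arcs_on_def nbrs_def)
  ultimately show ?thesis
    using card_unordered_pairs[OF finite_arcs_on[OF finite_lessThan]] parcs_mat_graph[OF assms(1)]
    by (simp add: graph_edges_def)
qed

lemma num_nonzero_eq:
  assumes "A \<in> carrier_mat n n" "\<And>i. i < n \<Longrightarrow> A $$ (i, i) \<noteq> 0"
  shows "num_nonzero A = n + card (arcs_on {..<n} (entries A))"
proof -
  have "{(i, j). i < dim_row A \<and> j < dim_col A \<and> A $$ (i, j) \<noteq> 0} =
      (\<lambda>i. (i, i)) ` {..<n} \<union> arcs_on {..<n} (entries A)"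
    using assms by (auto simp: arcs_on_def nbrs_def)
  hence "num_nonzero A = card ((\<lambda>i. (i, i)) ` {..<n} \<union> arcs_on {..<n} (entries A))"
    by (simp add: num_nonzero_def)
  also have "\<dots> = card ((\<lambda>i. (i, i)) ` {..<n}) + card (arcs_on {..<n} (entries A))"
    by (intro card_Un_disjoint finite_arcs_on) (auto simp: arcs_on_def nbrs_def)
  finally show ?thesis by (simp add: card_image inj_on_def)
qed

section \<open>Symplectic matrices\<close>

text \<open>The matrix \<open>\<Omega>\<close> is a signed permutation matrix: row \<open>i\<close> has its only entry, the sign
  \<open>omega_sign p i\<close>, in column \<open>partner p i\<close>.\<close>
definition partner :: "nat \<Rightarrow> nat \<Rightarrow> nat" where
  "partner p i = (if i < p then i + p else i - p)"

definition omega_sign :: "nat \<Rightarrow> nat \<Rightarrow> real" where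
  "omega_sign p i = (if i < p then 1 else - 1)"

lemma partner_lt: "i < 2 * p \<Longrightarrow> partner p i < 2 * p"
  and partner_partner: "i < 2 * p \<Longrightarrow> partner p (partner p i) = i"
  and partner_eq_iff: "i < 2 * p \<Longrightarrow> j < 2 * p \<Longrightarrow> partner p i = partner p j \<longleftrightarrow> i = j"
  by (auto simp: partner_def)

lemma Omega_mat_carrier: "Omega_mat p \<in> carrier_mat (2 * p) (2 * p)"
  by (auto simp: Omega_mat_def mult_2)

lemma Omega_mat_entry:
  assumes "i < 2 * p" "j < 2 * p"
  shows "Omega_mat p $$ (i, j) = (if j = partner p i then omega_sign p i else 0)"
  using assms by (auto simp: Omega_mat_def partner_def omega_sign_def)

lemma symplectic_entries:
  assumes N: "symplectic_mat p N" and sym: "transpose_mat N = N" and ij: "i < 2 * p" "j < 2 * p"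
  shows "(\<Sum>k<2 * p. N $$ (i, k) * (omega_sign p k * N $$ (partner p k, j))) =
    (if j = partner p i then omega_sign p i else 0)"
proof -
  have C: "N \<in> carrier_mat (2 * p) (2 * p)" and eq: "N * Omega_mat p * N = Omega_mat p"
    using N sym unfolding symplectic_mat_def by auto
  have ON: "(Omega_mat p * N) $$ (k, j) = omega_sign p k * N $$ (partner p k, j)" if k: "k < 2 * p" for k
  proof -
    have "(Omega_mat p * N) $$ (k, j) = (\<Sum>l<2 * p. Omega_mat p $$ (k, l) * N $$ (l, j))"
      using C Omega_mat_carrier[of p] k ij by (auto simp: scalar_prod_def lessThan_atLeast0 intro!: sum.cong)
    also have "\<dots> = (\<Sum>l<2 * p. if l = partner p k then omega_sign p k * N $$ (l, j) else 0)"
      using k by (intro sum.cong) (auto simp: Omega_mat_entry)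
    also have "\<dots> = omega_sign p k * N $$ (partner p k, j)" using partner_lt[OF k] by simp
    finally show ?thesis .
  qed
  have "N * (Omega_mat p * N) = Omega_mat p"
    using eq assoc_mult_mat[OF C Omega_mat_carrier C] by simp
  hence "Omega_mat p $$ (i, j) = (N * (Omega_mat p * N)) $$ (i, j)" by simp
  also have "\<dots> = (\<Sum>k<2 * p. N $$ (i, k) * (Omega_mat p * N) $$ (k, j))"
    using C Omega_mat_carrier[of p] ij by (auto simp: scalar_prod_def lessThan_atLeast0 intro!: sum.cong)
  also have "\<dots> = (\<Sum>k<2 * p. N $$ (i, k) * (omega_sign p k * N $$ (partner p k, j)))"
    using ON by (intro sum.cong) auto
  finally show ?thesis using Omega_mat_entry[OF ij] by simp
qed

text \<open>The matrix \<open>- \<Omega> N \<Omega>\<close>, which is the inverse of a symmetric symplectic \<open>N\<close>.\<close>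
definition symplectic_inverse :: "nat \<Rightarrow> real mat \<Rightarrow> nat \<Rightarrow> nat \<Rightarrow> real" where
  "symplectic_inverse p N i j =
     omega_sign p i * N $$ (partner p i, partner p j) * omega_sign p j"

lemma inverse_pair_symplectic:
  assumes S: "symplectic_mat p N" and pd: "pos_def_mat N"
  shows "inverse_pair {..<2 * p} (entries N) (symplectic_inverse p N)"
proof -
  have C: "N \<in> carrier_mat (2 * p) (2 * p)" using S unfolding symplectic_mat_def by simp
  have sym: "transpose_mat N = N" using pd unfolding pos_def_mat_def by simp
  note so = sym_on_entries[OF C sym]
  have "(\<Sum>k<2 * p. N $$ (i, k) * symplectic_inverse p N k j) = (if i = j then 1 else 0)"
    if ij: "i < 2 * p" "j < 2 * p" for i j
  proof -
    have "(\<Sum>k<2 * p. N $$ (i, k) * symplectic_inverse p N k j) =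
        (\<Sum>k<2 * p. N $$ (i, k) * (omega_sign p k * N $$ (partner p k, partner p j))) * omega_sign p j"
      by (simp add: symplectic_inverse_def sum_distrib_right mult.assoc)
    also have "\<dots> = (if i = j then 1 else 0)"
      unfolding symplectic_entries[OF S sym ij(1) partner_lt[OF ij(2)]]
      using partner_eq_iff[OF ij] by (auto simp: omega_sign_def)
    finally show ?thesis .
  qed
  moreover have "sym_on {..<2 * p} (symplectic_inverse p N)"
    using so partner_lt[of _ p] unfolding sym_on_def symplectic_inverse_def by simp
  ultimately show ?thesis
    using so pos_def_on_entries[OF C pd] unfolding inverse_pair_def by simp
qed

text \<open>Exchanging partners maps the graph of \<open>- \<Omega> N \<Omega>\<close> into the graph of \<open>N\<close>.\<close>
lemma card_arcs_symplectic_inverse: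
  "card (arcs_on {..<2 * p} (symplectic_inverse p N)) \<le> card (arcs_on {..<2 * p} (entries N))"
proof -
  let ?f = "map_prod (partner p) (partner p)"
  have "arcs_on {..<2 * p} (symplectic_inverse p N) \<subseteq> ?f ` arcs_on {..<2 * p} (entries N)"
  proof
    fix e assume e: "e \<in> arcs_on {..<2 * p} (symplectic_inverse p N)"
    have "?f e \<in> arcs_on {..<2 * p} (entries N)"
      using e by (auto simp: arcs_on_def nbrs_def symplectic_inverse_def partner_lt partner_eq_iff)
    moreover have "?f (?f e) = e" using e by (auto simp: arcs_on_def nbrs_def partner_partner)
    ultimately show "e \<in> ?f ` arcs_on {..<2 * p} (entries N)" by force
  qed
  thus ?thesis by (rule surj_card_le[rotated]) (simp add: finite_arcs_on)
qed

lemma irreducible_symplectic_arcs: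
  assumes S: "symplectic_mat p N" and pd: "pos_def_mat N" and p: "p \<ge> 1"
    and C: "connected_on {..<2 * p} (entries N)"
  shows "6 * p \<le> card (arcs_on {..<2 * p} (entries N)) + 4"
proof -
  have "{..<2 * p} \<noteq> {}" using p by (simp add: lessThan_empty_iff)
  from inverse_pair_arcs[OF inverse_pair_symplectic[OF S pd] C this] card_arcs_symplectic_inverse[of p N]
  show ?thesis by simp
qed

section \<open>Sharpness\<close>

text \<open>The adjacency matrix of a path with \<open>p\<close> vertices, with a loop at its first vertex. A
  path alone is bipartite, and \<open>sharp_mat\<close> below would split into two components; the loop joins
  them.\<close>
definition path_mat :: "nat \<Rightarrow> real mat" where
  "path_mat p = mat p p (\<lambda>(i, j). if i = 0 \<and> j = 0 \<or> i = Suc j \<or> j = Suc i then 1 else 0)"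

text \<open>For a symmetric block \<open>X\<close> the matrix \<open>[1, X; X, X\<^sup>2 + 1]\<close> is \<open>K\<^sup>T K\<close> with \<open>K = [1, X; 0, 1]\<close>,
  hence positive definite, and it is symplectic.\<close>
definition sharp_mat :: "nat \<Rightarrow> real mat" where
  "sharp_mat p = four_block_mat (1\<^sub>m p) (path_mat p) (path_mat p) (path_mat p * path_mat p + 1\<^sub>m p)"

lemma path_mat_carrier [simp]: "path_mat p \<in> carrier_mat p p"
  by (simp add: path_mat_def)

lemma transpose_path_mat [simp]: "transpose_mat (path_mat p) = path_mat p"
  by (rule eq_matI) (auto simp: path_mat_def)

lemma sharp_mat_carrier: "sharp_mat p \<in> carrier_mat (2 * p) (2 * p)"
  unfolding sharp_mat_def mult_2 by (intro four_block_carrier_mat) auto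

lemma pos_def_sharp_mat: "pos_def_mat (sharp_mat p)"
proof -
  let ?X = "path_mat p"
  let ?K = "four_block_mat (1\<^sub>m p) ?X (0\<^sub>m p p) (1\<^sub>m p)"
  let ?K' = "four_block_mat (1\<^sub>m p) (- ?X) (0\<^sub>m p p) (1\<^sub>m p)"
  have X: "?X \<in> carrier_mat p p" by simp
  have "?K' * ?K = four_block_mat (1\<^sub>m p) (0\<^sub>m p p) (0\<^sub>m p p) (1\<^sub>m p)"
    using X by (subst mult_four_block_mat[of _ p p _ p _ p _ _ p _ p])
      (auto intro!: cong_four_block_mat right_add_zero_mat left_add_zero_mat
        simp: left_mult_one_mat[OF X] right_mult_one_mat[OF uminus_carrier_mat[OF X]]
          left_mult_zero_mat[OF X] right_mult_zero_mat[OF uminus_carrier_mat[OF X]]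
          add_uminus_minus_mat[OF X X] minus_r_inv_mat[OF X])
  hence "?K' * ?K = 1\<^sub>m (p + p)" by simp
  hence "pos_def_mat (transpose_mat ?K * ?K)"
    by (intro pos_def_mat_gram[where K' = ?K' and n = "p + p"]) (auto intro!: four_block_carrier_mat)
  also have "transpose_mat ?K = four_block_mat (1\<^sub>m p) (0\<^sub>m p p) ?X (1\<^sub>m p)"
    by (subst transpose_four_block_mat[of _ p p _ p _ p]) auto
  also have "\<dots> * ?K = sharp_mat p"
    unfolding sharp_mat_def using X
    by (subst mult_four_block_mat[of _ p p _ p _ p _ _ p _ p])
      (auto intro!: cong_four_block_mat simp: left_mult_one_mat[OF X] right_mult_one_mat[OF X] right_add_zero_mat[OF X])
  finally show ?thesis .
qed

lemma symplectic_sharp_mat: "symplectic_mat p (sharp_mat p)"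
proof -
  let ?X = "path_mat p" and ?Y = "path_mat p * path_mat p"
  have X: "?X \<in> carrier_mat p p" by simp
  have Y: "?Y \<in> carrier_mat p p" using X by (rule mult_carrier_mat[OF X])
  have T: "transpose_mat (sharp_mat p) = sharp_mat p"
    using pos_def_sharp_mat unfolding pos_def_mat_def by blast
  have cube: "?Y * ?X = ?X * ?Y" by (rule assoc_mult_mat[OF X X X])
  have 1: "sharp_mat p * Omega_mat p = four_block_mat (- ?X) (1\<^sub>m p) (- (?Y + 1\<^sub>m p)) ?X"
    unfolding sharp_mat_def Omega_mat_def using X Y
    by (subst mult_four_block_mat[of _ p p _ p _ p _ _ p _ p])
      (auto intro!: cong_four_block_mat left_add_zero_mat right_add_zero_mat
        simp: right_mult_zero_mat[OF X])
  have "sharp_mat p * Omega_mat p * sharp_mat p =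
     four_block_mat (- ?X + ?X) (- ?X * ?X + (?Y + 1\<^sub>m p))
       (- (?Y + 1\<^sub>m p) + ?X * ?X) (- (?Y + 1\<^sub>m p) * ?X + ?X * (?Y + 1\<^sub>m p))"
    unfolding 1 unfolding sharp_mat_def using X Y
    by (subst mult_four_block_mat[of _ p p _ p _ p _ _ p _ p]) (auto intro!: cong_four_block_mat
        simp: left_mult_one_mat[OF X] right_mult_one_mat[OF uminus_carrier_mat[OF X]])
  also have "\<dots> = Omega_mat p"
    unfolding Omega_mat_def
  proof (intro cong_four_block_mat)
    show "- ?X + ?X = 0\<^sub>m p p" using X by (simp add: uminus_l_inv_mat)
    have cancel: "- Z + (Z + 1\<^sub>m p) = 1\<^sub>m p" "- (Z + 1\<^sub>m p) + Z = - 1\<^sub>m p"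
      if "Z \<in> carrier_mat p p" for Z :: "real mat"
      using that by (auto intro!: eq_matI)
    have e: "- ?X * ?X = - ?Y" by (rule uminus_mult_left_mat) (simp add: path_mat_def)
    show "- ?X * ?X + (?Y + 1\<^sub>m p) = 1\<^sub>m p" unfolding e using cancel(1)[OF Y] .
    show "- (?Y + 1\<^sub>m p) + ?Y = - 1\<^sub>m p" using cancel(2)[OF Y] .
    have f: "- (?Y + 1\<^sub>m p) * ?X = - (?Y * ?X + ?X)"
    proof -
      have "- (?Y + 1\<^sub>m p) * ?X = - ((?Y + 1\<^sub>m p) * ?X)"
        by (rule uminus_mult_left_mat) (simp add: path_mat_def)
      also have "(?Y + 1\<^sub>m p) * ?X = ?Y * ?X + ?X"
        using add_mult_distrib_mat[OF Y one_carrier_mat X] left_mult_one_mat[OF X] by simp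
      finally show ?thesis .
    qed
    have g: "?X * (?Y + 1\<^sub>m p) = ?Y * ?X + ?X"
      using mult_add_distrib_mat[OF X Y one_carrier_mat] right_mult_one_mat[OF X] cube by simp
    have "?Y * ?X + ?X \<in> carrier_mat p p" using X by simp
    thus "- (?Y + 1\<^sub>m p) * ?X + ?X * (?Y + 1\<^sub>m p) = 0\<^sub>m p p"
      unfolding f g by (simp add: uminus_l_inv_mat)
  qed
  finally show ?thesis unfolding symplectic_mat_def T using sharp_mat_carrier by simp
qed

lemma sharp_mat_off_diagonal_entry:
  assumes "u < p" "v < p"
  shows "sharp_mat p $$ (u, p + v) = path_mat p $$ (u, v)" "sharp_mat p $$ (p + u, v) = path_mat p $$ (u, v)"
  using assms by (auto simp: sharp_mat_def)

text \<open>The edges \<open>0 - p\<close>, \<open>i - (p + i + 1)\<close> and \<open>(i + 1) - (p + i)\<close> form a spanning path.\<close>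
lemma connected_on_sharp_mat: "connected_on {..<2 * p} (entries (sharp_mat p))"
  unfolding connected_on_def
proof (intro allI impI, rule ccontr)
  fix R assume R: "R \<subseteq> {..<2 * p} \<and> R \<noteq> {} \<and> R \<noteq> {..<2 * p}"
    and no: "\<not> (\<exists>i\<in>R. \<exists>j\<in>{..<2 * p} - R. sharp_mat p $$ (i, j) \<noteq> 0)"
  have link: "i \<in> R \<longleftrightarrow> p + j \<in> R" if "i < p" "j < p" "path_mat p $$ (i, j) \<noteq> 0" for i j
  proof -
    have "path_mat p $$ (j, i) \<noteq> 0" using that by (auto simp: path_mat_def split: if_splits)
    hence "sharp_mat p $$ (i, p + j) \<noteq> 0" "sharp_mat p $$ (p + j, i) \<noteq> 0"
      using that sharp_mat_off_diagonal_entry(1)[of i p j] sharp_mat_off_diagonal_entry(2)[of j p i] by auto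
    moreover have "i \<in> {..<2 * p}" "p + j \<in> {..<2 * p}" using that by auto
    ultimately show ?thesis using no by blast
  qed
  have all: "(i \<in> R \<longleftrightarrow> 0 \<in> R) \<and> (p + i \<in> R \<longleftrightarrow> 0 \<in> R)" if "i < p" for i
    using that
  proof (induction i)
    case 0
    thus ?case using link[of 0 0] by (simp add: path_mat_def)
  next
    case (Suc i)
    thus ?case using link[of "Suc i" i] link[of i "Suc i"] by (simp add: path_mat_def)
  qed
  have "k \<in> R \<longleftrightarrow> 0 \<in> R" if "k < 2 * p" for k
    using all[of k] all[of "k - p"] that by (cases "k < p") auto
  thus False using R by auto
qed

text \<open>The spanning path has \<open>2 p - 1\<close> edges. The block \<open>X\<^sup>2 + 1\<close> adds an edge for each pair of
  vertices at distance two on the path with \<open>p\<close> vertices, and the edge \<open>{p, p + 1}\<close> that the loop causes: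
  \<open>p - 1\<close> edges if \<open>p > 1\<close>. An upper bound is enough, as the general lower bound gives equality.\<close>
lemma card_graph_edges_sharp_mat_le:
  assumes p: "p \<ge> 1"
  shows "card (graph_edges (mat_graph (sharp_mat p))) \<le> 3 * p - 2"
proof -
  let ?X = "path_mat p"
  let ?A = "(\<lambda>i. {Suc i, p + i}) ` {..<p - 1}"
  let ?B = "(\<lambda>i. {i, p + Suc i}) ` {..<p - 1}"
  \<comment> \<open>The middle vertex \<open>i\<close> of a walk of length two; for \<open>i = 0\<close> the truncated \<open>i - 1\<close> is
    \<open>0\<close>, which is right because the first vertex carries the loop.\<close>
  let ?C = "(\<lambda>i. {p + (i - 1), p + Suc i}) ` {..<p - 1}"
  have T: "transpose_mat (sharp_mat p) = sharp_mat p"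
    using pos_def_sharp_mat unfolding pos_def_mat_def by blast
  have sym: "sharp_mat p $$ (u, v) = sharp_mat p $$ (v, u)" if "u < 2 * p" "v < 2 * p" for u v
    using sym_on_entries[OF sharp_mat_carrier T] that unfolding sym_on_def by simp
  have edge: "{u, v} \<in> insert {0, p} (?A \<union> ?B \<union> ?C)"
    if uv: "u < v" "v < 2 * p" "sharp_mat p $$ (u, v) \<noteq> 0" for u v
  proof -
    consider "v < p" | "u < p" "p \<le> v" | "p \<le> u" by linarith
    thus ?thesis
    proof cases
      case 1
      thus ?thesis using uv by (simp add: sharp_mat_def)
    next
      case 2
      then obtain w where w: "v = p + w" "w < p" using uv(2) by (metis add_less_cancel_left le_Suc_ex mult_2)
      have "?X $$ (u, w) \<noteq> 0" using uv(3) sharp_mat_off_diagonal_entry(1)[of u p w] 2 w by simp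
      then consider "u = 0" "w = 0" | "u = Suc w" | "w = Suc u"
        using 2 w by (auto simp: path_mat_def split: if_splits)
      thus ?thesis
      proof cases
        case 2
        have "w \<in> {..<p - 1}" using 2 \<open>u < p\<close> by auto
        thus ?thesis using 2 w(1) by blast
      next
        case 3
        have "u \<in> {..<p - 1}" using 3 w by auto
        thus ?thesis using 3 w(1) by blast
      qed (use w in auto)
    next
      case 3
      define a b where "a = u - p" and "b = v - p"
      hence ab: "u = p + a" "v = p + b" "a < b" "b < p" using 3 uv(1,2) by auto
      have "sharp_mat p $$ (u, v) = (\<Sum>k<p. ?X $$ (a, k) * ?X $$ (k, b))"
        using ab unfolding sharp_mat_def
        by (simp add: scalar_prod_def lessThan_atLeast0 path_mat_def)
      then obtain k where k: "k < p" "?X $$ (a, k) * ?X $$ (k, b) \<noteq> 0"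
        using uv(3) by (metis (no_types, lifting) lessThan_iff sum.neutral)
      hence "?X $$ (a, k) \<noteq> 0" "?X $$ (k, b) \<noteq> 0" by auto
      hence "(a = 0 \<and> k = 0 \<or> a = Suc k \<or> k = Suc a) \<and> (k = 0 \<and> b = 0 \<or> k = Suc b \<or> b = Suc k)"
        using k(1) ab by (auto simp: path_mat_def split: if_splits)
      hence "b = Suc k" "a = k - 1" using ab(3) by auto
      moreover from this have "k \<in> {..<p - 1}" using ab by auto
      ultimately show ?thesis using ab by blast
    qed
  qed
  have "graph_edges (mat_graph (sharp_mat p)) \<subseteq> insert {0, p} (?A \<union> ?B \<union> ?C)"
  proof
    fix e assume "e \<in> graph_edges (mat_graph (sharp_mat p))"
    then obtain u v where e: "e = {u, v}" and uv: "u < 2 * p" "v < 2 * p" "u \<noteq> v" "sharp_mat p $$ (u, v) \<noteq> 0"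
      using sharp_mat_carrier[of p] by (auto simp: graph_edges_def mat_graph_def)
    show "e \<in> insert {0, p} (?A \<union> ?B \<union> ?C)"
      using edge[of u v] edge[of v u] uv sym[of u v] e by (metis insert_commute linorder_neqE_nat)
  qed
  hence "card (graph_edges (mat_graph (sharp_mat p))) \<le> card (insert {0, p} (?A \<union> ?B \<union> ?C))"
    by (intro card_mono) auto
  also have "\<dots> \<le> Suc (card (?A \<union> ?B \<union> ?C))" by (rule card_insert_le_m1) auto
  finally have total: "card (graph_edges (mat_graph (sharp_mat p))) \<le> Suc (card (?A \<union> ?B \<union> ?C))" .
  have union: "card (?A \<union> ?B \<union> ?C) \<le> card ?A + card ?B + card ?C"
    by (meson add_le_mono1 card_Un_le order_trans)
  have parts: "card ?A \<le> p - 1" "card ?B \<le> p - 1" "card ?C \<le> p - 1"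
    using card_image_le[of "{..<p - 1}"] by (metis card_lessThan finite_lessThan)+
  show ?thesis using total union parts p by linarith
qed

theorem corollary2p10:
  fixes p n :: nat
  assumes "p \<ge> 1" and "n = 2 * p"
  shows
    "(\<forall>N. pos_def_mat N \<and> symplectic_mat p N \<longrightarrow>
        (irreducible_mat N \<longleftrightarrow> Digraph_Component.connected (with_proj (mat_graph N))) \<and>
        (irreducible_mat N \<longrightarrow>
           num_nonzero N \<ge> 4 * n - 4 \<and> card (graph_edges (mat_graph N)) \<ge> 3 * p - 2)) \<and>
     (\<exists>N. pos_def_mat N \<and> symplectic_mat p N \<and> irreducible_mat N \<and>
        num_nonzero N = 4 * n - 4 \<and> card (graph_edges (mat_graph N)) = 3 * p - 2)"
proof -
  have facts: "N \<in> carrier_mat (2 * p) (2 * p) \<and> transpose_mat N = N \<and>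
      num_nonzero N = 2 * p + 2 * card (graph_edges (mat_graph N)) \<and>
      (irreducible_mat N \<longrightarrow> 3 * p - 2 \<le> card (graph_edges (mat_graph N)))"
    if pd: "pos_def_mat N" and S: "symplectic_mat p N" for N
  proof -
    have C: "N \<in> carrier_mat (2 * p) (2 * p)" and sym: "transpose_mat N = N"
      using pd S unfolding symplectic_mat_def pos_def_mat_def by auto
    have "N $$ (i, i) \<noteq> 0" if "i < 2 * p" for i
      using pos_def_on_diag[OF _ pos_def_on_entries[OF C pd], of i] that by simp
    note nz = num_nonzero_eq[OF C this]
    have "3 * p - 2 \<le> card (graph_edges (mat_graph N))" if "irreducible_mat N"
      using that irreducible_mat_iff_connected_on[OF C sym] irreducible_symplectic_arcs[OF S pd assms(1)]
        card_graph_edges[OF C sym] by simp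
    thus ?thesis using C sym nz card_graph_edges[OF C sym] by simp
  qed
  show ?thesis
  proof (intro conjI allI impI)
    fix N assume "pos_def_mat N \<and> symplectic_mat p N"
    hence pd: "pos_def_mat N" and S: "symplectic_mat p N" by auto
    note F = facts[OF pd S]
    show "irreducible_mat N \<longleftrightarrow> Digraph_Component.connected (with_proj (mat_graph N))"
      using connected_mat_graph_iff[of N "2 * p"] irreducible_mat_iff_connected_on[of N "2 * p"] F assms(1)
      by simp
    assume I: "irreducible_mat N"
    show "3 * p - 2 \<le> card (graph_edges (mat_graph N))" using F I by blast
    thus "4 * n - 4 \<le> num_nonzero N" using F assms by linarith
  next
    note F = facts[OF pos_def_sharp_mat symplectic_sharp_mat]
    have I: "irreducible_mat (sharp_mat p)"
      using irreducible_mat_iff_connected_on[of "sharp_mat p" "2 * p"] F connected_on_sharp_mat by blast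
    have E: "card (graph_edges (mat_graph (sharp_mat p))) = 3 * p - 2"
      using F I card_graph_edges_sharp_mat_le[OF assms(1)] by (simp add: le_antisym)
    have "num_nonzero (sharp_mat p) = 4 * n - 4" using F E assms by simp
    thus "\<exists>N. pos_def_mat N \<and> symplectic_mat p N \<and> irreducible_mat N \<and>
        num_nonzero N = 4 * n - 4 \<and> card (graph_edges (mat_graph N)) = 3 * p - 2"
      using pos_def_sharp_mat symplectic_sharp_mat I E by blast
  qed
qed

end
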